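(* Suppose that $\mathcal{P}$ is bounded and that every linking variable is integer-constrained, i.e. $L = \{i \in \{1,\dots,n_1\} \mid A^2_i \neq 0\} \subseteq \{1,\dots,r_1\}$. Then $\operatorname{conv}(\mathcal{F})$ is a rational polyhedron.
   Context: Setting (mixed integer bilevel linear optimization). Let $X=\mathbb{Z}^{r_1}_+\times\mathbb{R}^{n_1-r_1}_+$ and $Y=\mathbb{Z}^{r_2}_+\times\mathbb{R}^{n_2-r_2}_+$ with $0\le r_1\le n_1$, $0\le r_2\le n_2$. The data are rational: $A^1\in\mathbb{Q}^{m_1\times n_1}$, $G^1\in\mathbb{Q}^{m_1\times n_2}$, $b^1\in\mathbb{Q}^{m_1}$, $A^2\in\mathbb{Q}^{m_2\times n_1}$, $G^2\in\mathbb{Q}^{m_2\times n_2}$, $b^2\in\mathbb{Q}^{m_2}$, $d^2\in\mathbb{Q}^{n_2}$. $A^2_i$ denotes the $i$-th column of $A^2$; the variables $x_i$, $i\in L$, are called linking variables. For $x\in\mathbb{R}^{n_1}$ put $$\mathcal{P}_1(x)=\{y\in\mathbb{R}^{n_2}_+\mid G^1y\ge b^1-A^1x\},\qquad \mathcal{P}_2(x)=\{y\in\mathbb{R}^{n_2}_+\mid G^2y\ge b^2-A^2x\}.$$ The feasible region of the LP relaxation is $$\mathcal{P}=\{(x,y)\in\mathbb{R}^{n_1+n_2}_+\mid y\in\mathcal{P}_1(x)\cap\mathcal{P}_2(x)\}.$$ The rational reaction set is $\mathcal{R}(x)=\operatorname{argmin}\{d^2y\mid y\in\mathcal{P}_2(x)\cap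 Y\}$, and the bilevel feasible region is $$\mathcal{F}=\{(x,y)\in X\times Y\mid y\in\mathcal{P}_1(x)\cap\mathcal{R}(x)\}.$$ A rational polyhedron is a set of the form $\{z\mid Cz\ge c\}$ with a finite rational matrix $C$ and rational vector $c$ (the empty set included). *)

theory Defs
  imports Complex_Main "Jordan_Normal_Form.Matrix"
begin

text \<open>
  Dimensions are natural numbers, possibly zero, and \<open>\<real>\<^sup>n\<close> is \<^term>\<open>carrier_vec n :: real vec set\<close>.
  Coordinates are numbered from 0, so the first \<open>r\<close> coordinates are those with \<open>i < r\<close>.
  Inequalities between vectors are the componentwise order, which also requires equal dimensions.
  A point \<open>(x, y)\<close> of \<open>\<real>\<^bsup>n1\<^esup> \<times> \<real>\<^bsup>n2\<^esup>\<close> is the vector \<^term>\<open>x @\<^sub>v y\<close> in \<open>\<real>\<^bsup>n1+n2\<^esup>\<close>.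
\<close>

abbreviation real_mat :: "rat mat \<Rightarrow> real mat" where
  "real_mat \<equiv> map_mat real_of_rat"

abbreviation real_vec :: "rat vec \<Rightarrow> real vec" where
  "real_vec \<equiv> map_vec real_of_rat"

subsection \<open>Convexity, boundedness and polyhedra for carrier-based vectors\<close>

text \<open>
  The type \<^typ>\<open>real vec\<close> contains vectors of all dimensions and is not a real vector space,
  so \<open>convex\<close> and \<open>bounded\<close> from \<open>HOL-Analysis\<close> do not apply to it. The definitions below
  follow the library ones; the hull operator is the library's.
\<close>

definition convex_vec :: "real vec set \<Rightarrow> bool" where
  "convex_vec S \<longleftrightarrow>
    (\<forall>u\<in>S. \<forall>v\<in>S. \<forall>a\<ge>0. \<forall>b\<ge>0. a + b = 1 \<longrightarrow> a \<cdot>\<^sub>v u + b \<cdot>\<^sub>v v \<in> S)"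

definition conv :: "real vec set \<Rightarrow> real vec set" where
  "conv S = convex_vec hull S"

definition bounded_vec :: "real vec set \<Rightarrow> bool" where
  "bounded_vec S \<longleftrightarrow> (\<exists>B. \<forall>z\<in>S. sqrt (z \<bullet> z) \<le> B)"

definition rational_polyhedron :: "nat \<Rightarrow> real vec set \<Rightarrow> bool" where
  "rational_polyhedron n S \<longleftrightarrow>
    (\<exists>m. \<exists>C \<in> carrier_mat m n. \<exists>c \<in> carrier_vec m.
      S = {z \<in> carrier_vec n. real_mat C *\<^sub>v z \<ge> real_vec c})"

subsection \<open>Mixed integer bilevel linear optimization\<close>

text \<open>The set \<open>\<int>\<^bsup>r\<^esup>\<^sub>+ \<times> \<real>\<^bsup>n-r\<^esup>\<^sub>+\<close>, meaningful for \<open>r \<le> n\<close>.\<close>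

definition mixed_int :: "nat \<Rightarrow> nat \<Rightarrow> real vec set" where
  "mixed_int r n = {z \<in> carrier_vec n. z \<ge> 0\<^sub>v n \<and> (\<forall>i<r. z $ i \<in> \<int>)}"

text \<open>
  \<open>\<P>\<^sub>k(x)\<close> for the constraint data \<open>A\<^sup>k, G\<^sup>k, b\<^sup>k\<close> of either level; the argument \<open>n\<close> is the
  number of second-level variables.
\<close>

definition level_set :: "nat \<Rightarrow> rat mat \<Rightarrow> rat mat \<Rightarrow> rat vec \<Rightarrow> real vec \<Rightarrow> real vec set" where
  "level_set n A G b x =
    {y \<in> carrier_vec n. y \<ge> 0\<^sub>v n \<and> real_mat G *\<^sub>v y \<ge> real_vec b - real_mat A *\<^sub>v x}"

definition lp_relaxation ::
  "nat \<Rightarrow> nat \<Rightarrow> rat mat \<Rightarrow> rat mat \<Rightarrow> rat vec \<Rightarrow> rat mat \<Rightarrow> rat mat \<Rightarrow> rat vec \<Rightarrow> real vec set" where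
  "lp_relaxation n1 n2 A1 G1 b1 A2 G2 b2 =
    {x @\<^sub>v y | x y. x \<in> carrier_vec n1 \<and> x \<ge> 0\<^sub>v n1
      \<and> y \<in> level_set n2 A1 G1 b1 x \<inter> level_set n2 A2 G2 b2 x}"

definition rational_reaction ::
  "nat \<Rightarrow> nat \<Rightarrow> rat mat \<Rightarrow> rat mat \<Rightarrow> rat vec \<Rightarrow> rat vec \<Rightarrow> real vec \<Rightarrow> real vec set" where
  "rational_reaction r2 n2 A2 G2 b2 d2 x =
    {y. is_arg_min (\<lambda>y. real_vec d2 \<bullet> y) (\<lambda>y. y \<in> level_set n2 A2 G2 b2 x \<inter> mixed_int r2 n2) y}"

definition bilevel_feasible ::
  "nat \<Rightarrow> nat \<Rightarrow> nat \<Rightarrow> nat \<Rightarrow> rat mat \<Rightarrow> rat mat \<Rightarrow> rat vec \<Rightarrow> rat mat \<Rightarrow> rat mat \<Rightarrow> rat vec \<Rightarrow> rat vec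
    \<Rightarrow> real vec set" where
  "bilevel_feasible r1 n1 r2 n2 A1 G1 b1 A2 G2 b2 d2 =
    {x @\<^sub>v y | x y. x \<in> mixed_int r1 n1 \<and> y \<in> mixed_int r2 n2
      \<and> y \<in> level_set n2 A1 G1 b1 x \<inter> rational_reaction r2 n2 A2 G2 b2 d2 x}"

definition linking :: "rat mat \<Rightarrow> nat set" where
  "linking A2 = {i. i < dim_col A2 \<and> col A2 i \<noteq> 0\<^sub>v (dim_row A2)}"

end

theory Submission
  imports Defs
begin

text \<open>
  The bilevel feasible region is a finite union of rational polytopes, and the convex hull of a
  finite union of rational polytopes is again a rational polytope.

  For the first claim, prescribe the values of all integer-constrained coordinates of \<open>x\<close> and
  \<open>y\<close>. Boundedness of the relaxation leaves finitely many choices. The choice fixes the linking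
  variables, and the second-level problem depends on \<open>x\<close> through \<open>A\<^sup>2x\<close>, hence through the linking
  variables alone: all points of such a fibre share one second-level feasible set and one optimal
  value \<open>\<phi>\<close>. So optimality of \<open>y\<close> turns into the single linear inequality \<open>d\<^sup>2y \<le> \<phi>\<close>
  (\<open>rational_polyhedron_bilevel_fibre\<close>). For this to be a rational inequality \<open>\<phi>\<close> has to be
  rational. It is the minimum of a rational linear program, obtained by also fixing the integer
  coordinates of an optimal \<open>y\<close>; the attained values of the objective form a rational polyhedron
  on the line, whose least point is an end point cut out by a rational inequality
  (\<open>optimal_value_rational\<close>).

  For the second claim it is enough to treat two nonempty polytopes \<open>P\<close> and \<open>Q\<close>. By Balas'
  construction their hull is the projection of a polyhedron in more variables: \<open>z\<close> lies in it iff
  \<open>z = v + w\<close> where, for some \<open>t \<in> [0, 1]\<close>, the vector \<open>v\<close> satisfies the inequalities of \<open>P\<close> with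
  right-hand side scaled by \<open>t\<close>, and \<open>w\<close> those of \<open>Q\<close> scaled by \<open>1 - t\<close>
  (\<open>rational_polyhedron_conv_Un\<close>). Boundedness enters at \<open>t = 0\<close> and \<open>t = 1\<close>, where a nonzero
  recession direction would add points.

  Both claims rest on one tool only, Fourier-Motzkin elimination (\<open>rat_system_ex\<close>): projections of
  rational polyhedra are rational polyhedra.
\<close>

section \<open>Systems of rational linear inequalities\<close>

text \<open>
  Points are functions on the naturals of which only the values below \<open>n\<close> matter. This makes adding
  and eliminating variables an update or a case distinction on the index, with no
  concatenation of vectors.
\<close>

definition rat_affine :: "nat \<Rightarrow> ((nat \<Rightarrow> real) \<Rightarrow> real) \<Rightarrow> bool" where
  "rat_affine n f \<longleftrightarrow>
    (\<exists>a b. f = (\<lambda>x. (\<Sum>i<n. real_of_rat (a i) * x i) + real_of_rat b))"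

definition rat_system :: "nat \<Rightarrow> ((nat \<Rightarrow> real) \<Rightarrow> bool) \<Rightarrow> bool" where
  "rat_system n P \<longleftrightarrow>
    (\<exists>F. finite F \<and> (\<forall>f\<in>F. rat_affine n f) \<and> (\<forall>x. P x \<longleftrightarrow> (\<forall>f\<in>F. 0 \<le> f x)))"

text \<open>
  The closure properties up to \<open>rat_intros\<close> reduce the recognition of a rational system to
  matching its syntax, so no constraint matrix has to be written down for it.
\<close>

lemma rat_affine_const: "c \<in> \<rat> \<Longrightarrow> rat_affine n (\<lambda>x. c)"
  unfolding rat_affine_def
  by (elim Rats_cases, rule exI[of _ "\<lambda>_. 0"], auto)

lemma rat_affine_coord:
  assumes "i < n"
  shows "rat_affine n (\<lambda>x. x i)"
proof -
  have "(\<Sum>j<n. real_of_rat (if j = i then 1 else 0) * x j) = x i" for x :: "nat \<Rightarrow> real"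
    using assms by (subst sum.remove[of _ i]) auto
  then show ?thesis
    unfolding rat_affine_def
    by (intro exI[of _ "\<lambda>j. if j = i then 1 else 0"] exI[of _ 0]) (auto simp: fun_eq_iff)
qed

lemma rat_affine_add:
  assumes "rat_affine n f" and "rat_affine n g"
  shows "rat_affine n (\<lambda>x. f x + g x)"
proof -
  from assms obtain a b a' b'
    where "f = (\<lambda>x. (\<Sum>i<n. real_of_rat (a i) * x i) + real_of_rat b)"
      and "g = (\<lambda>x. (\<Sum>i<n. real_of_rat (a' i) * x i) + real_of_rat b')"
    unfolding rat_affine_def by blast
  then show ?thesis
    unfolding rat_affine_def
    by (intro exI[of _ "\<lambda>i. a i + a' i"] exI[of _ "b + b'"])
       (auto simp: of_rat_add distrib_right sum.distrib)
qed

lemma rat_affine_scale: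
  assumes "c \<in> \<rat>" and "rat_affine n f"
  shows "rat_affine n (\<lambda>x. c * f x)"
proof -
  from assms obtain q a b
    where "c = real_of_rat q"
      and "f = (\<lambda>x. (\<Sum>i<n. real_of_rat (a i) * x i) + real_of_rat b)"
    unfolding rat_affine_def by (auto elim: Rats_cases)
  then show ?thesis
    unfolding rat_affine_def
    by (intro exI[of _ "\<lambda>i. q * a i"] exI[of _ "q * b"])
       (auto simp: of_rat_mult distrib_left sum_distrib_left mult.assoc)
qed

lemma rat_affine_diff:
  assumes "rat_affine n f" and "rat_affine n g"
  shows "rat_affine n (\<lambda>x. f x - g x)"
  using rat_affine_add[OF assms(1) rat_affine_scale[OF _ assms(2), of "-1"]] by simp

lemma rat_affine_sum:
  assumes "finite I" and "\<And>i. i \<in> I \<Longrightarrow> rat_affine n (f i)"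
  shows "rat_affine n (\<lambda>x. \<Sum>i\<in>I. f i x)"
  using assms by (induction I rule: finite_induct) (auto intro: rat_affine_const rat_affine_add)

lemma rat_affine_cong:
  assumes "rat_affine n f" and "\<And>i. i < n \<Longrightarrow> x i = y i"
  shows "f x = f y"
  using assms unfolding rat_affine_def by (auto intro!: sum.cong)

lemma rat_system_cong:
  assumes "rat_system n P" and "\<And>i. i < n \<Longrightarrow> x i = y i"
  shows "P x \<longleftrightarrow> P y"
proof -
  from assms(1) obtain F where F: "\<forall>f\<in>F. rat_affine n f" "\<forall>x. P x \<longleftrightarrow> (\<forall>f\<in>F. 0 \<le> f x)"
    unfolding rat_system_def by blast
  have "0 \<le> f x \<longleftrightarrow> 0 \<le> f y" if "f \<in> F" for f
    using rat_affine_cong[of n f x y] that F(1) assms(2) by simp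
  then have "(\<forall>f\<in>F. 0 \<le> f x) \<longleftrightarrow> (\<forall>f\<in>F. 0 \<le> f y)" by (intro ball_cong refl)
  with F(2) show ?thesis by simp
qed

lemma rat_system_const: "rat_system n (\<lambda>x. Q)"
proof (cases Q)
  case True
  then show ?thesis unfolding rat_system_def by (intro exI[of _ "{}"]) auto
next
  case False
  have "rat_affine n (\<lambda>x. -1)" by (rule rat_affine_const) simp
  with False show ?thesis unfolding rat_system_def by (intro exI[of _ "{\<lambda>x. -1}"]) auto
qed

lemma rat_system_le:
  assumes "rat_affine n f" and "rat_affine n g"
  shows "rat_system n (\<lambda>x. f x \<le> g x)"
  unfolding rat_system_def
  using rat_affine_diff[OF assms(2,1)] by (intro exI[of _ "{\<lambda>x. g x - f x}"]) auto

lemma rat_system_conj: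
  assumes "rat_system n P" and "rat_system n Q"
  shows "rat_system n (\<lambda>x. P x \<and> Q x)"
proof -
  from assms obtain F G
    where "finite F" "\<forall>f\<in>F. rat_affine n f" "\<forall>x. P x \<longleftrightarrow> (\<forall>f\<in>F. 0 \<le> f x)"
      and "finite G" "\<forall>f\<in>G. rat_affine n f" "\<forall>x. Q x \<longleftrightarrow> (\<forall>f\<in>G. 0 \<le> f x)"
    unfolding rat_system_def by blast
  then show ?thesis unfolding rat_system_def by (intro exI[of _ "F \<union> G"]) auto
qed

lemma rat_system_eq:
  assumes "rat_affine n f" and "rat_affine n g"
  shows "rat_system n (\<lambda>x. f x = g x)"
proof -
  have "f x = g x \<longleftrightarrow> f x \<le> g x \<and> g x \<le> f x" for x by linarith
  then show ?thesis
    using rat_system_conj[OF rat_system_le[OF assms] rat_system_le[OF assms(2,1)]] by simp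
qed

lemma rat_system_imp: "(Q \<Longrightarrow> rat_system n P) \<Longrightarrow> rat_system n (\<lambda>x. Q \<longrightarrow> P x)"
  by (cases Q) (auto intro: rat_system_const)

lemma rat_system_ball:
  assumes "finite I" and "\<And>i. i \<in> I \<Longrightarrow> rat_system n (P i)"
  shows "rat_system n (\<lambda>x. \<forall>i\<in>I. P i x)"
  using assms
  by (induction I rule: finite_induct) (auto intro: rat_system_const rat_system_conj)

lemma rat_system_all_less:
  fixes m :: nat
  assumes "\<And>i. i < m \<Longrightarrow> rat_system n (P i)"
  shows "rat_system n (\<lambda>x. \<forall>i<m. P i x)"
  using rat_system_ball[of "{..<m}" n P] assms by (simp add: Ball_def)

lemmas rat_intros =
  rat_affine_coord rat_affine_add rat_affine_scale rat_affine_diff rat_affine_sum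
  rat_system_le rat_system_eq rat_system_conj rat_system_imp rat_system_ball rat_system_all_less

section \<open>Fourier-Motzkin elimination\<close>

lemma rat_affine_split_last:
  assumes "rat_affine (Suc n) f"
  shows "\<exists>g c. rat_affine n g \<and> c \<in> \<rat> \<and> (\<forall>x t. f (x(n := t)) = g x + c * t)"
proof -
  from assms obtain a b
    where f: "f = (\<lambda>x. (\<Sum>i<Suc n. real_of_rat (a i) * x i) + real_of_rat b)"
    unfolding rat_affine_def by blast
  let ?g = "\<lambda>x. (\<Sum>i<n. real_of_rat (a i) * x i) + real_of_rat b"
  have "rat_affine n ?g" unfolding rat_affine_def by blast
  moreover have "f (x(n := t)) = ?g x + real_of_rat (a n) * t" for x t
    by (simp add: f)
  ultimately show ?thesis by (meson Rats_of_rat)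
qed

lemma between_finite_sets:
  fixes L U :: "real set"
  assumes "finite L" "finite U" and "\<And>l u. l \<in> L \<Longrightarrow> u \<in> U \<Longrightarrow> l \<le> u"
  shows "\<exists>t. (\<forall>l\<in>L. l \<le> t) \<and> (\<forall>u\<in>U. t \<le> u)"
proof (cases "L = {}")
  case True
  show ?thesis
  proof (cases "U = {}")
    case False
    with True \<open>finite U\<close> show ?thesis by (intro exI[of _ "Min U"]) auto
  qed (use True in auto)
next
  case False
  with assms show ?thesis by (intro exI[of _ "Max L"]) auto
qed

text \<open>
  Solve every inequality for the last variable. A positive coefficient gives a lower bound for it, a
  negative one an upper bound, and a value exists iff each lower bound is at most each upper
  bound. Clearing denominators turns these comparisons into inequalities affine in the remaining
  variables.
\<close>

lemma rat_system_ex_last: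
  assumes "rat_system (Suc n) P"
  shows "rat_system n (\<lambda>x. \<exists>t. P (x(n := t)))"
proof -
  from assms obtain F where F: "finite F" "\<forall>f\<in>F. rat_affine (Suc n) f"
    and P: "\<And>x. P x \<longleftrightarrow> (\<forall>f\<in>F. 0 \<le> f x)"
    unfolding rat_system_def by blast
  from F(2) rat_affine_split_last have
    "\<forall>f\<in>F. \<exists>g c. rat_affine n g \<and> c \<in> \<rat> \<and> (\<forall>x t. f (x(n := t)) = g x + c * t)"
    by blast
  then obtain g c where g: "\<And>f. f \<in> F \<Longrightarrow> rat_affine n (g f)"
    and c: "\<And>f. f \<in> F \<Longrightarrow> c f \<in> \<rat>"
    and gc: "\<And>f x t. f \<in> F \<Longrightarrow> f (x(n := t)) = g f x + c f * t"
    by metis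
  let ?Q = "\<lambda>x. (\<forall>f\<in>F. c f = 0 \<longrightarrow> 0 \<le> g f x) \<and>
    (\<forall>f\<in>F. \<forall>h\<in>F. c f > 0 \<and> c h < 0 \<longrightarrow> c h * g f x \<le> c f * g h x)"
  have "(\<exists>t. P (x(n := t))) \<longleftrightarrow> ?Q x" for x
  proof
    assume "\<exists>t. P (x(n := t))"
    then obtain t where t: "\<And>f. f \<in> F \<Longrightarrow> 0 \<le> g f x + c f * t"
      using P gc by auto
    have "c h * g f x \<le> c f * g h x" if "f \<in> F" "h \<in> F" "c f > 0" "c h < 0" for f h
    proof -
      have "c f * (g h x + c h * t) \<ge> 0" "c h * (g f x + c f * t) \<le> 0"
        using t[OF that(1)] t[OF that(2)] that(3,4)
        by (auto simp: mult_nonpos_nonneg)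
      then show ?thesis by (simp add: algebra_simps)
    qed
    moreover have "0 \<le> g f x" if "f \<in> F" "c f = 0" for f
      using t[OF that(1)] that(2) by simp
    ultimately show "?Q x" by blast
  next
    assume Q: "?Q x"
    \<comment> \<open>The lower and upper bounds on the eliminated variable.\<close>
    let ?L = "(\<lambda>f. - g f x / c f) ` {f\<in>F. c f > 0}"
    let ?U = "(\<lambda>f. - g f x / c f) ` {f\<in>F. c f < 0}"
    have "\<exists>t. (\<forall>l\<in>?L. l \<le> t) \<and> (\<forall>u\<in>?U. t \<le> u)"
    proof (rule between_finite_sets)
      fix l u assume "l \<in> ?L" "u \<in> ?U"
      then obtain f h where fh: "f \<in> F" "c f > 0" "h \<in> F" "c h < 0"
        and l: "l = - g f x / c f" and u: "u = - g h x / c h" by auto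
      with Q have "c h * g f x \<le> c f * g h x" by blast
      with fh show "l \<le> u" unfolding l u by (simp add: field_simps)
    qed (use F(1) in auto)
    then obtain t where t: "\<And>f. f \<in> F \<Longrightarrow> c f > 0 \<Longrightarrow> - g f x / c f \<le> t"
      "\<And>f. f \<in> F \<Longrightarrow> c f < 0 \<Longrightarrow> t \<le> - g f x / c f" by auto
    have "0 \<le> g f x + c f * t" if "f \<in> F" for f
    proof (cases "c f" "0::real" rule: linorder_cases)
      case less
      with t(2)[OF that] show ?thesis by (simp add: field_simps)
    next
      case equal
      with Q that show ?thesis by simp
    next
      case greater
      with t(1)[OF that] show ?thesis by (simp add: field_simps)
    qed
    then show "\<exists>t. P (x(n := t))" by (intro exI[of _ t]) (simp add: P gc)
  qed
  moreover have "rat_system n ?Q"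
    by (intro rat_intros F(1) g c rat_affine_const) auto
  ultimately show ?thesis by simp
qed

lemma rat_system_ex:
  assumes "rat_system (n + k) P"
  shows "rat_system n (\<lambda>x. \<exists>y. P (\<lambda>i. if i < n then x i else y i))"
  using assms
proof (induction k arbitrary: P)
  case 0
  then have "P (\<lambda>i. if i < n then x i else y i) \<longleftrightarrow> P x" for x y
    by (intro rat_system_cong[of n P]) auto
  with 0 show ?case by simp
next
  case (Suc k)
  have glue: "(\<lambda>i. if i < n then x i else y i)(n + k := t)
      = (\<lambda>i. if i < n then x i else (y(n + k := t)) i)" for x y :: "nat \<Rightarrow> real" and t
    by auto
  have ex_eq: "(\<exists>y t. P ((\<lambda>i. if i < n then x i else y i)(n + k := t)))
      \<longleftrightarrow> (\<exists>y. P (\<lambda>i. if i < n then x i else y i))" for x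
  proof
    assume "\<exists>y. P (\<lambda>i. if i < n then x i else y i)"
    then obtain y where "P (\<lambda>i. if i < n then x i else y i)" by (rule exE)
    then have "P (\<lambda>i. if i < n then x i else (y(n + k := y (n + k))) i)"
      by (simp only: fun_upd_triv)
    then show "\<exists>y t. P ((\<lambda>i. if i < n then x i else y i)(n + k := t))"
      unfolding glue by (intro exI)
  next
    assume "\<exists>y t. P ((\<lambda>i. if i < n then x i else y i)(n + k := t))"
    then obtain y t where "P (\<lambda>i. if i < n then x i else (y(n + k := t)) i)"
      unfolding glue by (elim exE)
    then show "\<exists>y. P (\<lambda>i. if i < n then x i else y i)" by (rule exI[of _ "y(n + k := t)"])
  qed
  have "rat_system (n + k) (\<lambda>x. \<exists>t. P (x(n + k := t)))"
    by (rule rat_system_ex_last[of "n + k" P]) (use Suc.prems in simp)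
  from Suc.IH[OF this] show ?case by (simp only: ex_eq)
qed

text \<open>
  If \<open>x 0\<close> were irrational, every constraint with positive slope would be strict there, because its
  zero is rational. The others are not violated by moving left, so \<open>x 0\<close> could be decreased slightly.
\<close>

lemma rat_system_min_rational:
  assumes sys: "rat_system 1 P" and P: "P x" and min: "\<And>y. P y \<Longrightarrow> x 0 \<le> y 0"
  shows "x 0 \<in> \<rat>"
proof (rule ccontr)
  assume irr: "x 0 \<notin> \<rat>"
  from sys obtain F where F: "finite F" "\<forall>f\<in>F. rat_affine 1 f"
    and PF: "\<And>x. P x \<longleftrightarrow> (\<forall>f\<in>F. 0 \<le> f x)"
    unfolding rat_system_def by blast
  have "\<forall>f\<in>F. \<exists>e>0. \<forall>d. 0 < d \<and> d \<le> e \<longrightarrow> 0 \<le> f (x(0 := x 0 - d))"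
  proof
    fix f assume "f \<in> F"
    with F(2) obtain a b where f: "\<And>x. f x = real_of_rat a * x 0 + real_of_rat b"
      unfolding rat_affine_def by auto
    from PF P \<open>f \<in> F\<close> have f0: "0 \<le> real_of_rat a * x 0 + real_of_rat b" by (auto simp: f)
    show "\<exists>e>0. \<forall>d. 0 < d \<and> d \<le> e \<longrightarrow> 0 \<le> f (x(0 := x 0 - d))"
    proof (cases "a > 0")
      case False
      then have neg: "real_of_rat a * d \<le> 0" if "d > 0" for d
        using that by (simp add: mult_le_0_iff)
      have "0 \<le> f (x(0 := x 0 - d))" if "d > 0" for d
        using f0 neg[OF that] by (simp add: f algebra_simps)
      then show ?thesis by (intro exI[of _ 1]) simp
    next
      case True
      let ?e = "x 0 + real_of_rat (b / a)"
      have "?e \<ge> 0" using f0 True by (simp add: of_rat_divide field_simps)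
      moreover have "?e \<noteq> 0"
      proof
        assume "?e = 0"
        then have "x 0 = real_of_rat (- (b / a))" by (simp add: of_rat_minus)
        with irr show False by simp
      qed
      moreover have "0 \<le> f (x(0 := x 0 - d))" if "d \<le> ?e" for d
        using that True by (simp add: f of_rat_divide field_simps)
      ultimately show ?thesis by (intro exI[of _ ?e]) auto
    qed
  qed
  then obtain e where e: "\<And>f. f \<in> F \<Longrightarrow> e f > 0"
    "\<And>f d. f \<in> F \<Longrightarrow> 0 < d \<Longrightarrow> d \<le> e f \<Longrightarrow> 0 \<le> f (x(0 := x 0 - d))"
    by metis
  \<comment> \<open>The 1 covers the case of an empty system.\<close>
  define d where "d = Min (insert 1 (e ` F))"
  have "d > 0" "\<And>f. f \<in> F \<Longrightarrow> d \<le> e f" using F(1) e(1) by (auto simp: d_def)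
  then have "P (x(0 := x 0 - d))" using e(2) PF by blast
  from min[OF this] \<open>d > 0\<close> show False by simp
qed

section \<open>Rational polyhedra as solution sets of rational systems\<close>

lemma mat_vec_le_iff:
  assumes "C \<in> carrier_mat m n" "c \<in> carrier_vec m" "z \<in> carrier_vec n"
  shows "real_vec c \<le> real_mat C *\<^sub>v z \<longleftrightarrow>
    (\<forall>i<m. real_of_rat (c $ i) \<le> (\<Sum>j<n. real_of_rat (C $$ (i, j)) * z $ j))"
  using assms by (auto simp: less_eq_vec_def scalar_prod_def atLeast0LessThan)

text \<open>
  Presents a polyhedron by coefficient functions with explicit sums, the form in which linear
  systems are built up from \<open>rat_intros\<close>.
\<close>

lemma rational_polyhedronE:
  assumes "rational_polyhedron n S"
  obtains m and C :: "nat \<Rightarrow> nat \<Rightarrow> rat" and c :: "nat \<Rightarrow> rat" where "S = {z \<in> carrier_vec n.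
    \<forall>i<m. real_of_rat (c i) \<le> (\<Sum>j<n. real_of_rat (C i j) * z $ j)}"
proof -
  from assms obtain m C c where C: "C \<in> carrier_mat m n" and c: "c \<in> carrier_vec m"
    and S: "S = {z \<in> carrier_vec n. real_mat C *\<^sub>v z \<ge> real_vec c}"
    unfolding rational_polyhedron_def by blast
  have "S = {z \<in> carrier_vec n.
    \<forall>i<m. real_of_rat (c $ i) \<le> (\<Sum>j<n. real_of_rat (C $$ (i, j)) * z $ j)}"
    unfolding S using mat_vec_le_iff[OF C c] by auto
  then show thesis by (rule that[where C = "\<lambda>i j. C $$ (i, j)" and c = "($) c"])
qed

lemma rational_polyhedron_carrier: "rational_polyhedron n S \<Longrightarrow> S \<subseteq> carrier_vec n"
  unfolding rational_polyhedron_def by auto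

lemma rational_polyhedron_solutions:
  assumes "rat_system n P"
  shows "rational_polyhedron n {z \<in> carrier_vec n. P (($) z)}"
proof -
  from assms obtain F where F: "finite F" "\<forall>f\<in>F. rat_affine n f"
    and P: "\<And>x. P x \<longleftrightarrow> (\<forall>f\<in>F. 0 \<le> f x)"
    unfolding rat_system_def by blast
  from F(1) obtain fs where fs: "set fs = F" using finite_list by blast
  from F(2) obtain a b
    where ab: "\<And>f x. f \<in> F \<Longrightarrow> f x = (\<Sum>i<n. real_of_rat (a f i) * x i) + real_of_rat (b f)"
    unfolding rat_affine_def by metis
  let ?m = "length fs"
  let ?C = "mat ?m n (\<lambda>(i, j). a (fs ! i) j)" and ?c = "vec ?m (\<lambda>i. - b (fs ! i))"
  have "real_mat ?C *\<^sub>v z \<ge> real_vec ?c \<longleftrightarrow> P (($) z)" if z: "z \<in> carrier_vec n" for z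
  proof -
    have "P (($) z) \<longleftrightarrow> (\<forall>i<?m. 0 \<le> (fs ! i) (($) z))"
      using P fs by (metis in_set_conv_nth)
    also have "\<dots> \<longleftrightarrow> (\<forall>i<?m. - real_of_rat (b (fs ! i))
        \<le> (\<Sum>j<n. real_of_rat (a (fs ! i) j) * z $ j))"
    proof -
      have "(fs ! i) (($) z) = (\<Sum>j<n. real_of_rat (a (fs ! i) j) * z $ j)
        + real_of_rat (b (fs ! i))" if "i < ?m" for i
        using that fs by (intro ab) auto
      then show ?thesis by (auto simp: field_simps)
    qed
    also have "\<dots> \<longleftrightarrow> real_mat ?C *\<^sub>v z \<ge> real_vec ?c"
      by (subst mat_vec_le_iff[of _ ?m n]) (auto simp: z of_rat_minus)
    finally show ?thesis by simp
  qed
  then show ?thesis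
    unfolding rational_polyhedron_def
    by (intro exI[of _ ?m] bexI[of _ ?C] bexI[of _ ?c]) auto
qed

section \<open>Convex hulls of finite unions of polytopes\<close>

text \<open>
  A bound in this form passes to convex hulls because the box it describes is convex by a
  computation in each coordinate separately.
\<close>

definition coord_bounded :: "nat \<Rightarrow> real vec set \<Rightarrow> bool" where
  "coord_bounded n S \<longleftrightarrow> (\<exists>B. \<forall>z\<in>S. \<forall>i<n. \<bar>z $ i\<bar> \<le> B)"

lemma coord_bounded_if_bounded_vec:
  assumes "bounded_vec S" and "S \<subseteq> carrier_vec n"
  shows "coord_bounded n S"
proof -
  from assms(1) obtain B where B: "\<And>z. z \<in> S \<Longrightarrow> sqrt (z \<bullet> z) \<le> B"
    unfolding bounded_vec_def by blast
  have "\<bar>z $ i\<bar> \<le> B" if z: "z \<in> S" and i: "i < n" for z i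
  proof -
    have "dim_vec z = n" using assms(2) z by auto
    then have "z $ i * z $ i \<le> z \<bullet> z"
      using i unfolding scalar_prod_def by (intro member_le_sum) auto
    then have "sqrt (z $ i * z $ i) \<le> sqrt (z \<bullet> z)" by (rule real_sqrt_le_mono)
    with B[OF z] show ?thesis by simp
  qed
  then show ?thesis unfolding coord_bounded_def by blast
qed

lemma conv_minimal: "S \<subseteq> T \<Longrightarrow> convex_vec T \<Longrightarrow> conv S \<subseteq> T"
  unfolding conv_def by (rule hull_minimal)

lemma subset_conv: "S \<subseteq> conv S"
  unfolding conv_def by (rule hull_subset)

lemma convex_conv: "convex_vec (conv S)"
  unfolding conv_def
proof (rule hull_in)
  fix F assume "Ball F convex_vec"
  then show "convex_vec (\<Inter> F)" unfolding convex_vec_def by fastforce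
qed

lemma coord_bounded_conv:
  assumes S: "S \<subseteq> carrier_vec n" and "coord_bounded n S"
  shows "coord_bounded n (conv S)"
proof -
  from assms obtain B where B: "\<And>z i. z \<in> S \<Longrightarrow> i < n \<Longrightarrow> \<bar>z $ i\<bar> \<le> B"
    unfolding coord_bounded_def by blast
  let ?T = "{z \<in> carrier_vec n. \<forall>i<n. \<bar>z $ i\<bar> \<le> B}"
  have "convex_vec ?T"
    unfolding convex_vec_def
  proof (safe)
    fix u v :: "real vec" and a b :: real and i
    assume uv: "u \<in> carrier_vec n" "v \<in> carrier_vec n" and a: "0 \<le> a" "0 \<le> b" "a + b = 1"
      and u: "\<forall>i<n. \<bar>u $ i\<bar> \<le> B" and v: "\<forall>i<n. \<bar>v $ i\<bar> \<le> B" and i: "i < n"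
    have "\<bar>a * u $ i + b * v $ i\<bar> \<le> a * \<bar>u $ i\<bar> + b * \<bar>v $ i\<bar>"
      using abs_triangle_ineq[of "a * u $ i" "b * v $ i"] a by (simp add: abs_mult)
    also have "\<dots> \<le> B" using a u v i by (intro convex_bound_le) auto
    finally show "\<bar>(a \<cdot>\<^sub>v u + b \<cdot>\<^sub>v v) $ i\<bar> \<le> B" using uv i by simp
  qed auto
  then have "conv S \<subseteq> ?T" using S B by (intro conv_minimal) auto
  then show ?thesis unfolding coord_bounded_def by blast
qed

text \<open>
  The segments between \<open>P\<close> and \<open>Q\<close> already form a convex set: in a combination of two segment
  points, the parts from \<open>P\<close> merge into a multiple of one point of \<open>P\<close>, and likewise for \<open>Q\<close>.
\<close>

lemma conv_Un_convex:
  assumes P: "convex_vec P" "P \<noteq> {}" "P \<subseteq> carrier_vec n"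
    and Q: "convex_vec Q" "Q \<noteq> {}" "Q \<subseteq> carrier_vec n"
  shows "conv (P \<union> Q) = {t \<cdot>\<^sub>v p + (1 - t) \<cdot>\<^sub>v q | t p q. 0 \<le> t \<and> t \<le> 1 \<and> p \<in> P \<and> q \<in> Q}"
    (is "_ = ?K")
proof
  have "P \<subseteq> ?K"
  proof
    fix p assume "p \<in> P"
    obtain q where "q \<in> Q" using Q(2) by blast
    then have "p \<in> carrier_vec n" "q \<in> carrier_vec n" using \<open>p \<in> P\<close> P(3) Q(3) by auto
    then have "p = 1 \<cdot>\<^sub>v p + (1 - 1) \<cdot>\<^sub>v q" by (intro eq_vecI) auto
    with \<open>p \<in> P\<close> \<open>q \<in> Q\<close> show "p \<in> ?K" by (intro CollectI exI[of _ "1::real"] exI) auto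
  qed
  moreover have "Q \<subseteq> ?K"
  proof
    fix q assume "q \<in> Q"
    obtain p where "p \<in> P" using P(2) by blast
    then have "p \<in> carrier_vec n" "q \<in> carrier_vec n" using \<open>q \<in> Q\<close> P(3) Q(3) by auto
    then have "q = 0 \<cdot>\<^sub>v p + (1 - 0) \<cdot>\<^sub>v q" by (intro eq_vecI) auto
    with \<open>p \<in> P\<close> \<open>q \<in> Q\<close> show "q \<in> ?K" by (intro CollectI exI[of _ "0::real"] exI) auto
  qed
  moreover have "convex_vec ?K"
    unfolding convex_vec_def
  proof (intro ballI allI impI)
    fix u v :: "real vec" and a b :: real
    assume "u \<in> ?K" "v \<in> ?K" and ab: "0 \<le> a" "0 \<le> b" "a + b = 1"
    then obtain t p q t' p' q'
      where u: "u = t \<cdot>\<^sub>v p + (1 - t) \<cdot>\<^sub>v q" "0 \<le> t" "t \<le> 1" "p \<in> P" "q \<in> Q"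
        and v: "v = t' \<cdot>\<^sub>v p' + (1 - t') \<cdot>\<^sub>v q'" "0 \<le> t'" "t' \<le> 1" "p' \<in> P" "q' \<in> Q"
      by blast
    have mix: "\<exists>r\<in>R. \<forall>i<n. \<alpha> * x $ i + \<beta> * y $ i = (\<alpha> + \<beta>) * r $ i"
      if R: "convex_vec R" "R \<subseteq> carrier_vec n" "x \<in> R" "y \<in> R" and \<alpha>: "0 \<le> \<alpha>" "0 \<le> \<beta>"
      for R x y and \<alpha> \<beta> :: real
    proof (cases "\<alpha> + \<beta> = 0")
      case True
      with \<alpha> have "\<alpha> = 0" "\<beta> = 0" by auto
      with R(3) show ?thesis by auto
    next
      case False
      let ?r = "(\<alpha> / (\<alpha> + \<beta>)) \<cdot>\<^sub>v x + (\<beta> / (\<alpha> + \<beta>)) \<cdot>\<^sub>v y"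
      have "?r \<in> R" using R \<alpha> False unfolding convex_vec_def
        by (simp add: add_divide_distrib[symmetric])
      moreover have "x \<in> carrier_vec n" "y \<in> carrier_vec n" using R by auto
      then have "\<forall>i<n. \<alpha> * x $ i + \<beta> * y $ i = (\<alpha> + \<beta>) * ?r $ i"
        using False by (simp add: distrib_left)
      ultimately show ?thesis by blast
    qed
    obtain r where r: "r \<in> P" "\<And>i. i < n \<Longrightarrow> (a * t) * p $ i + (b * t') * p' $ i = (a * t + b * t') * r $ i"
      using mix[OF P(1,3) u(4) v(4), of "a * t" "b * t'"] ab u v by auto
    obtain s where s: "s \<in> Q" "\<And>i. i < n \<Longrightarrow> (a * (1 - t)) * q $ i + (b * (1 - t')) * q' $ i
        = (a * (1 - t) + b * (1 - t')) * s $ i"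
      using mix[OF Q(1,3) u(5) v(5), of "a * (1 - t)" "b * (1 - t')"] ab u v by auto
    have coeff: "a * (1 - t) + b * (1 - t') = 1 - (a * t + b * t')"
      using ab by (simp add: algebra_simps)
    have carr: "p \<in> carrier_vec n" "q \<in> carrier_vec n" "p' \<in> carrier_vec n" "q' \<in> carrier_vec n"
      "r \<in> carrier_vec n" "s \<in> carrier_vec n"
      using u v r s P Q by auto
    have "a \<cdot>\<^sub>v u + b \<cdot>\<^sub>v v = (a * t + b * t') \<cdot>\<^sub>v r + (1 - (a * t + b * t')) \<cdot>\<^sub>v s"
    proof (rule eq_vecI)
      fix i assume "i < dim_vec ((a * t + b * t') \<cdot>\<^sub>v r + (1 - (a * t + b * t')) \<cdot>\<^sub>v s)"
      with carr have i: "i < n" by auto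
      have "(a \<cdot>\<^sub>v u + b \<cdot>\<^sub>v v) $ i = ((a * t) * p $ i + (b * t') * p' $ i)
          + ((a * (1 - t)) * q $ i + (b * (1 - t')) * q' $ i)"
        using carr i by (simp add: u(1) v(1) algebra_simps)
      then show "(a \<cdot>\<^sub>v u + b \<cdot>\<^sub>v v) $ i
        = ((a * t + b * t') \<cdot>\<^sub>v r + (1 - (a * t + b * t')) \<cdot>\<^sub>v s) $ i"
        unfolding r(2)[OF i] s(2)[OF i] coeff using carr i by simp
    qed (use carr u v in auto)
    moreover have "0 \<le> a * t + b * t'" "a * t + b * t' \<le> 1"
      using ab u v by (auto intro: convex_bound_le)
    ultimately show "a \<cdot>\<^sub>v u + b \<cdot>\<^sub>v v \<in> ?K" using r(1) s(1) by blast
  qed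
  ultimately show "conv (P \<union> Q) \<subseteq> ?K" by (intro conv_minimal) auto
  show "?K \<subseteq> conv (P \<union> Q)"
  proof safe
    fix t p q assume t: "0 \<le> t" "t \<le> (1::real)" and "p \<in> P" "q \<in> Q"
    then have "p \<in> conv (P \<union> Q)" "q \<in> conv (P \<union> Q)"
      using subset_conv[of "P \<union> Q"] by auto
    with t convex_conv[of "P \<union> Q"] show "t \<cdot>\<^sub>v p + (1 - t) \<cdot>\<^sub>v q \<in> conv (P \<union> Q)"
      unfolding convex_vec_def by simp
  qed
qed

lemma convex_rational_polyhedron:
  assumes "rational_polyhedron n S"
  shows "convex_vec S"
proof -
  from assms obtain m and C :: "nat \<Rightarrow> nat \<Rightarrow> rat" and c where S: "S = {z \<in> carrier_vec n.
    \<forall>i<m. real_of_rat (c i) \<le> (\<Sum>j<n. real_of_rat (C i j) * z $ j)}"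
    by (rule rational_polyhedronE)
  show ?thesis
    unfolding convex_vec_def
  proof (intro ballI allI impI)
    fix u v and a b :: real
    assume uv: "u \<in> S" "v \<in> S" and ab: "0 \<le> a" "0 \<le> b" "a + b = 1"
    let ?l = "\<lambda>i z. \<Sum>j<n. real_of_rat (C i j) * z $ j"
    have "real_of_rat (c i) \<le> ?l i (a \<cdot>\<^sub>v u + b \<cdot>\<^sub>v v)" if "i < m" for i
    proof -
      have "?l i (a \<cdot>\<^sub>v u + b \<cdot>\<^sub>v v) = a * ?l i u + b * ?l i v"
        using uv unfolding S
        by (auto simp: sum_distrib_left sum.distrib[symmetric] algebra_simps intro!: sum.cong)
      moreover have "a * real_of_rat (c i) + b * real_of_rat (c i) \<le> a * ?l i u + b * ?l i v"
        using uv ab that unfolding S by (intro add_mono mult_left_mono) auto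
      ultimately show ?thesis using ab by (simp add: distrib_right[symmetric])
    qed
    with uv show "a \<cdot>\<^sub>v u + b \<cdot>\<^sub>v v \<in> S" unfolding S by auto
  qed
qed

text \<open>
  Scaling the right-hand side of a system by \<open>t\<close> scales its solution set by \<open>t\<close>. For \<open>t > 0\<close> this is
  division by \<open>t\<close>. For \<open>t = 0\<close> the scaled system describes the recession cone of \<open>S\<close>, which is
  \<open>{0}\<close> because \<open>S\<close> is nonempty and bounded.
\<close>

lemma homogenization_iff:
  fixes C :: "nat \<Rightarrow> nat \<Rightarrow> rat" and c :: "nat \<Rightarrow> rat"
  assumes S: "S = {z \<in> carrier_vec n.
      \<forall>i<m. real_of_rat (c i) \<le> (\<Sum>j<n. real_of_rat (C i j) * z $ j)}"
    and "S \<noteq> {}" and "coord_bounded n S" and t: "0 \<le> t"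
  shows "(\<forall>i<m. real_of_rat (c i) * t \<le> (\<Sum>j<n. real_of_rat (C i j) * w j))
    \<longleftrightarrow> (\<exists>p\<in>S. \<forall>j<n. w j = t * p $ j)" (is "?H \<longleftrightarrow> _")
proof
  assume "\<exists>p\<in>S. \<forall>j<n. w j = t * p $ j"
  then obtain p where p: "p \<in> S" "\<forall>j<n. w j = t * p $ j" by blast
  have "(\<Sum>j<n. real_of_rat (C i j) * w j) = t * (\<Sum>j<n. real_of_rat (C i j) * p $ j)" for i
    using p(2) by (simp add: sum_distrib_left mult.left_commute)
  moreover have "t * real_of_rat (c i) \<le> t * (\<Sum>j<n. real_of_rat (C i j) * p $ j)" if "i < m" for i
    using p(1) t that unfolding S by (intro mult_left_mono) auto
  ultimately show ?H by (simp add: mult.commute)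
next
  assume H: ?H
  show "\<exists>p\<in>S. \<forall>j<n. w j = t * p $ j"
  proof (cases "t = 0")
    case False
    let ?p = "vec n (\<lambda>j. w j / t)"
    have "?p \<in> S"
    proof -
      have eq: "(\<Sum>j<n. real_of_rat (C i j) * ?p $ j) = (\<Sum>j<n. real_of_rat (C i j) * w j) / t" for i
        by (simp add: sum_divide_distrib)
      have "real_of_rat (c i) \<le> (\<Sum>j<n. real_of_rat (C i j) * ?p $ j)" if "i < m" for i
        unfolding eq using H t False that by (simp add: pos_le_divide_eq)
      then show ?thesis unfolding S by auto
    qed
    with False show ?thesis by (intro bexI[of _ ?p]) auto
  next
    case True
    obtain p where p: "p \<in> S" using \<open>S \<noteq> {}\<close> by blast
    obtain B where B: "\<And>z i. z \<in> S \<Longrightarrow> i < n \<Longrightarrow> \<bar>z $ i\<bar> \<le> B"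
      using \<open>coord_bounded n S\<close> unfolding coord_bounded_def by blast
    have "w j = 0" if j: "j < n" for j
    proof (rule ccontr)
      assume "w j \<noteq> 0"
      \<comment> \<open>Moving this far along \<open>w\<close> changes coordinate \<open>j\<close> by more than the width \<open>2 * B\<close> of the box.\<close>
      define s where "s = (2 * B + 1) / \<bar>w j\<bar>"
      have "B \<ge> 0" using B[OF p j] by linarith
      then have s: "s \<ge> 0" by (simp add: s_def)
      let ?q = "vec n (\<lambda>j. p $ j + s * w j)"
      have "?q \<in> S"
      proof -
        have "(\<Sum>j<n. real_of_rat (C i j) * ?q $ j)
          = (\<Sum>j<n. real_of_rat (C i j) * p $ j) + s * (\<Sum>j<n. real_of_rat (C i j) * w j)" for i
          by (simp add: sum_distrib_left sum.distrib[symmetric] algebra_simps)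
        moreover have "0 \<le> s * (\<Sum>j<n. real_of_rat (C i j) * w j)" if "i < m" for i
          using H True s that by simp
        ultimately show ?thesis using p unfolding S by (auto intro: add_increasing2)
      qed
      from B[OF this j] B[OF p j] j have "\<bar>s * w j\<bar> \<le> 2 * B" by simp
      moreover have "\<bar>s * w j\<bar> = 2 * B + 1"
        using \<open>w j \<noteq> 0\<close> \<open>B \<ge> 0\<close> by (simp add: s_def abs_mult)
      ultimately show False by simp
    qed
    with p True show ?thesis by auto
  qed
qed

text \<open>
  Balas' extended formulation, followed by elimination of the auxiliary variables. The hull
  consists of the sums \<open>t p + (1 - t) q\<close>; its products of variables disappear when \<open>v = t p\<close>
  is taken as the unknown.
\<close>

lemma rational_polyhedron_conv_Un:
  assumes P: "rational_polyhedron n P" "coord_bounded n P" "P \<noteq> {}"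
    and Q: "rational_polyhedron n Q" "coord_bounded n Q" "Q \<noteq> {}"
  shows "rational_polyhedron n (conv (P \<union> Q))"
proof -
  obtain m and C :: "nat \<Rightarrow> nat \<Rightarrow> rat" and c where PS: "P = {z \<in> carrier_vec n.
      \<forall>i<m. real_of_rat (c i) \<le> (\<Sum>j<n. real_of_rat (C i j) * z $ j)}"
    using P(1) by (rule rational_polyhedronE)
  obtain k and D :: "nat \<Rightarrow> nat \<Rightarrow> rat" and d where QS: "Q = {z \<in> carrier_vec n.
      \<forall>i<k. real_of_rat (d i) \<le> (\<Sum>j<n. real_of_rat (D i j) * z $ j)}"
    using Q(1) by (rule rational_polyhedronE)
  \<comment> \<open>Variables: \<open>z\<close> at the indices below \<open>n\<close>, then \<open>v\<close>, and \<open>t\<close> at index \<open>n + n\<close>.\<close>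
  define E where "E = (\<lambda>f :: nat \<Rightarrow> real. 0 \<le> f (n + n) \<and> f (n + n) \<le> 1
    \<and> (\<forall>i<m. real_of_rat (c i) * f (n + n) \<le> (\<Sum>j<n. real_of_rat (C i j) * f (n + j)))
    \<and> (\<forall>i<k. real_of_rat (d i) * (1 - f (n + n))
        \<le> (\<Sum>j<n. real_of_rat (D i j) * (f j - f (n + j)))))"
  have "rat_system (n + Suc n) E"
    unfolding E_def by (intro rat_intros rat_affine_const) auto
  then have "rat_system n (\<lambda>z. \<exists>y. E (\<lambda>i. if i < n then z i else y i))"
    by (rule rat_system_ex)
  then have "rational_polyhedron n
      {z \<in> carrier_vec n. \<exists>y. E (\<lambda>i. if i < n then z $ i else y i)}"
    by (rule rational_polyhedron_solutions)
  also have "{z \<in> carrier_vec n. \<exists>y. E (\<lambda>i. if i < n then z $ i else y i)} =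
    {t \<cdot>\<^sub>v p + (1 - t) \<cdot>\<^sub>v q | t p q. 0 \<le> t \<and> t \<le> 1 \<and> p \<in> P \<and> q \<in> Q}" (is "?L = ?R")
  proof
    have E: "E (\<lambda>i. if i < n then z i else y i) \<longleftrightarrow> 0 \<le> y (n + n) \<and> y (n + n) \<le> 1
      \<and> (\<exists>p\<in>P. \<forall>j<n. y (n + j) = y (n + n) * p $ j)
      \<and> (\<exists>q\<in>Q. \<forall>j<n. z j - y (n + j) = (1 - y (n + n)) * q $ j)" for z y
      unfolding E_def
      using homogenization_iff[OF PS P(3,2), of "y (n + n)" "\<lambda>j. y (n + j)"]
        homogenization_iff[OF QS Q(3,2), of "1 - y (n + n)" "\<lambda>j. z j - y (n + j)"]
      by auto
    show "?L \<subseteq> ?R"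
    proof
      fix z assume "z \<in> ?L"
      then obtain y p q where z: "z \<in> carrier_vec n" and y: "0 \<le> y (n + n)" "y (n + n) \<le> 1"
        and p: "p \<in> P" "\<forall>j<n. y (n + j) = y (n + n) * p $ j"
        and q: "q \<in> Q" "\<forall>j<n. z $ j - y (n + j) = (1 - y (n + n)) * q $ j"
        unfolding E by blast
      have "z = y (n + n) \<cdot>\<^sub>v p + (1 - y (n + n)) \<cdot>\<^sub>v q"
        using z p q unfolding PS QS by (intro eq_vecI) (auto simp: algebra_simps)
      with y p(1) q(1) show "z \<in> ?R" by blast
    qed
    show "?R \<subseteq> ?L"
    proof safe
      fix t :: real and p q assume t: "0 \<le> t" "t \<le> 1" and pq: "p \<in> P" "q \<in> Q"
      then have carr: "p \<in> carrier_vec n" "q \<in> carrier_vec n" unfolding PS QS by auto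
      then show "t \<cdot>\<^sub>v p + (1 - t) \<cdot>\<^sub>v q \<in> carrier_vec n" by auto
      let ?y = "\<lambda>i. if i < n + n then t * p $ (i - n) else t"
      have "E (\<lambda>i. if i < n then (t \<cdot>\<^sub>v p + (1 - t) \<cdot>\<^sub>v q) $ i else ?y i)"
        unfolding E using t pq carr by auto
      then show "\<exists>y. E (\<lambda>i. if i < n then (t \<cdot>\<^sub>v p + (1 - t) \<cdot>\<^sub>v q) $ i else y i)"
        by (rule exI[of _ ?y])
    qed
  qed
  also have "\<dots> = conv (P \<union> Q)"
    using P Q by (intro conv_Un_convex[symmetric, of _ n] convex_rational_polyhedron[of n]
        rational_polyhedron_carrier)
  finally show ?thesis .
qed

lemma rational_polyhedron_empty: "rational_polyhedron n {}"
  using rational_polyhedron_solutions[OF rat_system_const[of n False]] by simp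

lemma conv_rational_polyhedron: "rational_polyhedron n S \<Longrightarrow> conv S = S"
  by (metis convex_rational_polyhedron conv_minimal order_refl subset_antisym subset_conv)

lemma conv_Un_conv: "conv (S \<union> conv T) = conv (S \<union> T)"
proof (rule antisym)
  have "conv T \<subseteq> conv (S \<union> T)"
    using subset_conv[of "S \<union> T"] by (intro conv_minimal convex_conv) auto
  then show "conv (S \<union> conv T) \<subseteq> conv (S \<union> T)"
    using subset_conv[of "S \<union> T"] by (intro conv_minimal convex_conv) auto
  show "conv (S \<union> T) \<subseteq> conv (S \<union> conv T)"
    using subset_conv[of "S \<union> conv T"] subset_conv[of T] by (intro conv_minimal convex_conv) auto
qed

text \<open>
  Induction on the number of polyhedra: the hull of the previous ones is a bounded rational polyhedron
  by the induction hypothesis, and replacing a set by its hull inside a union does not change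
  the hull of the union.
\<close>

lemma rational_polyhedron_conv_UN:
  assumes "finite I" and "\<And>i. i \<in> I \<Longrightarrow> rational_polyhedron n (P i)"
    and "coord_bounded n (\<Union>i\<in>I. P i)"
  shows "rational_polyhedron n (conv (\<Union>i\<in>I. P i))"
  using assms
proof (induction I rule: finite_induct)
  case empty
  then show ?case
    using rational_polyhedron_empty[of n] by (simp add: conv_rational_polyhedron)
next
  case (insert i I)
  let ?Q = "\<Union>i\<in>I. P i"
  have bdd: "coord_bounded n (P i)" "coord_bounded n ?Q"
    using insert.prems(2) unfolding coord_bounded_def by auto
  have Pi: "rational_polyhedron n (P i)" and Q: "rational_polyhedron n (conv ?Q)"
    using insert bdd by auto
  have "?Q \<subseteq> carrier_vec n" using insert.prems(1) rational_polyhedron_carrier by blast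
  then have Qb: "coord_bounded n (conv ?Q)" using bdd by (intro coord_bounded_conv)
  have eq: "conv (\<Union>j\<in>insert i I. P j) = conv (P i \<union> conv ?Q)"
    by (simp add: conv_Un_conv)
  consider "P i = {}" | "?Q = {}" | "P i \<noteq> {}" "?Q \<noteq> {}" by blast
  then show ?case
  proof cases
    case 1
    with Q show ?thesis by simp
  next
    case 2
    then show ?thesis using Pi conv_rational_polyhedron[OF Pi] by simp
  next
    case 3
    then have "conv ?Q \<noteq> {}" using subset_conv[of ?Q] by blast
    with 3 show ?thesis unfolding eq by (intro rational_polyhedron_conv_Un Pi bdd Q Qb)
  qed
qed

section \<open>The bilevel feasible region\<close>

lemma mem_level_set_iff:
  assumes "A \<in> carrier_mat m n1" "G \<in> carrier_mat m n" "b \<in> carrier_vec m" "x \<in> carrier_vec n1"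
  shows "y \<in> level_set n A G b x \<longleftrightarrow> y \<in> carrier_vec n \<and> (\<forall>i<n. 0 \<le> y $ i) \<and>
    (\<forall>i<m. real_of_rat (b $ i) - (\<Sum>j<n1. real_of_rat (A $$ (i, j)) * x $ j)
      \<le> (\<Sum>j<n. real_of_rat (G $$ (i, j)) * y $ j))"
proof (cases "y \<in> carrier_vec n")
  case True
  then have "0\<^sub>v n \<le> y \<longleftrightarrow> (\<forall>i<n. 0 \<le> y $ i)"
    by (simp add: less_eq_vec_def)
  moreover have "real_vec b - real_mat A *\<^sub>v x \<le> real_mat G *\<^sub>v y \<longleftrightarrow>
    (\<forall>i<m. real_of_rat (b $ i) - (\<Sum>j<n1. real_of_rat (A $$ (i, j)) * x $ j)
      \<le> (\<Sum>j<n. real_of_rat (G $$ (i, j)) * y $ j))"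
    using assms True by (simp add: less_eq_vec_def scalar_prod_def atLeast0LessThan)
  ultimately show ?thesis using True unfolding level_set_def by simp
qed (simp add: level_set_def)

lemma mem_mixed_int_iff:
  "z \<in> mixed_int r n \<longleftrightarrow> z \<in> carrier_vec n \<and> (\<forall>i<n. 0 \<le> z $ i) \<and> (\<forall>i<r. z $ i \<in> \<int>)"
  unfolding mixed_int_def by (auto simp: less_eq_vec_def)

lemma mem_rational_reaction_iff:
  assumes "d \<in> carrier_vec n"
  shows "y \<in> rational_reaction r n A G b d x \<longleftrightarrow> y \<in> level_set n A G b x \<inter> mixed_int r n \<and>
    (\<forall>y' \<in> level_set n A G b x \<inter> mixed_int r n.
      (\<Sum>j<n. real_of_rat (d $ j) * y $ j) \<le> (\<Sum>j<n. real_of_rat (d $ j) * y' $ j))"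
proof -
  have "real_vec d \<bullet> y = (\<Sum>j<n. real_of_rat (d $ j) * y $ j)" if "y \<in> mixed_int r n" for y
    using that assms unfolding mixed_int_def by (auto simp: scalar_prod_def atLeast0LessThan)
  then show ?thesis
    unfolding rational_reaction_def is_arg_min_def by (auto simp: not_less)
qed

lemma append_mem_bilevel_feasible_iff:
  assumes "x \<in> carrier_vec n1"
  shows "x @\<^sub>v y \<in> bilevel_feasible r1 n1 r2 n2 A1 G1 b1 A2 G2 b2 d2 \<longleftrightarrow>
    x \<in> mixed_int r1 n1 \<and> y \<in> mixed_int r2 n2 \<and> y \<in> level_set n2 A1 G1 b1 x
    \<and> y \<in> rational_reaction r2 n2 A2 G2 b2 d2 x" (is "_ \<longleftrightarrow> ?R")
proof
  assume "x @\<^sub>v y \<in> bilevel_feasible r1 n1 r2 n2 A1 G1 b1 A2 G2 b2 d2"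
  then obtain x' y' where eq: "x @\<^sub>v y = x' @\<^sub>v y'" and x': "x' \<in> mixed_int r1 n1"
    and y': "y' \<in> mixed_int r2 n2" "y' \<in> level_set n2 A1 G1 b1 x'"
      "y' \<in> rational_reaction r2 n2 A2 G2 b2 d2 x'"
    unfolding bilevel_feasible_def by blast
  have "x = x' \<and> y = y'"
    using eq assms x' append_vec_eq[of x n1 x' y y'] by (simp add: mem_mixed_int_iff)
  with x' y' show ?R by blast
next
  assume ?R
  then show "x @\<^sub>v y \<in> bilevel_feasible r1 n1 r2 n2 A1 G1 b1 A2 G2 b2 d2"
    unfolding bilevel_feasible_def by blast
qed

lemma bilevel_feasible_subset_lp_relaxation:
  "bilevel_feasible r1 n1 r2 n2 A1 G1 b1 A2 G2 b2 d2 \<subseteq> lp_relaxation n1 n2 A1 G1 b1 A2 G2 b2"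
proof
  fix z assume "z \<in> bilevel_feasible r1 n1 r2 n2 A1 G1 b1 A2 G2 b2 d2"
  then obtain x y where "z = x @\<^sub>v y" "x \<in> mixed_int r1 n1" "y \<in> level_set n2 A1 G1 b1 x"
    "y \<in> rational_reaction r2 n2 A2 G2 b2 d2 x"
    unfolding bilevel_feasible_def by blast
  moreover from this have "y \<in> level_set n2 A2 G2 b2 x"
    unfolding rational_reaction_def is_arg_min_def by blast
  ultimately show "z \<in> lp_relaxation n1 n2 A1 G1 b1 A2 G2 b2"
    unfolding lp_relaxation_def mixed_int_def by blast
qed

lemma nonlinking_entry_zero:
  assumes "A \<in> carrier_mat m n" "linking A \<subseteq> {..<r}" "r \<le> j" "j < n" "i < m"
  shows "A $$ (i, j) = 0"
proof -
  have "col A j = 0\<^sub>v m" using assms unfolding linking_def by auto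
  then have "col A j $ i = 0" using assms(5) by simp
  then show ?thesis using assms by simp
qed

text \<open>
  This is how the assumption on the linking variables is used: the contribution of \<open>x\<close> to the
  second-level constraints depends only on its integer-constrained coordinates.
\<close>

lemma linking_sum_eq:
  assumes "A \<in> carrier_mat m n" "linking A \<subseteq> {..<r}" "r \<le> n" "i < m"
  shows "(\<Sum>j<n. real_of_rat (A $$ (i, j)) * x j) = (\<Sum>j<r. real_of_rat (A $$ (i, j)) * x j)"
  using assms by (intro sum.mono_neutral_right) (auto simp: nonlinking_entry_zero[of A m n r])

text \<open>
  Fixing the integer coordinates of the optimal \<open>y\<close> leaves a rational linear program with the same
  optimal value. Projecting its graph to the objective value gives a rational system in one
  variable, of which the optimal value is the least solution.
\<close>

lemma optimal_value_rational:
  assumes A: "A \<in> carrier_mat m n1" and G: "G \<in> carrier_mat m n" and b: "b \<in> carrier_vec m"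
    and d: "d \<in> carrier_vec n" and x: "x \<in> carrier_vec n1" and r: "r \<le> n"
    and Ax: "\<And>i. i < m \<Longrightarrow> (\<Sum>j<n1. real_of_rat (A $$ (i, j)) * x $ j) \<in> \<rat>"
    and y: "y \<in> rational_reaction r n A G b d x"
  shows "(\<Sum>j<n. real_of_rat (d $ j) * y $ j) \<in> \<rat>"
proof -
  define s where "s = (\<lambda>i. \<Sum>j<n1. real_of_rat (A $$ (i, j)) * x $ j)"
  have s: "s i \<in> \<rat>" if "i < m" for i using Ax[OF that] by (simp add: s_def)
  have level: "y \<in> level_set n A G b x \<longleftrightarrow> y \<in> carrier_vec n \<and> (\<forall>i<n. 0 \<le> y $ i)
      \<and> (\<forall>i<m. real_of_rat (b $ i) - s i \<le> (\<Sum>j<n. real_of_rat (G $$ (i, j)) * y $ j))" for y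
    by (simp add: s_def mem_level_set_iff[OF A G b x])
  note react = mem_rational_reaction_iff[OF d, of _ r A G b x]
  from y have yl: "y \<in> level_set n A G b x" and ym: "y \<in> mixed_int r n" unfolding react by auto
  then have y_rat: "y $ i \<in> \<rat>" if "i < r" for i
    using that Ints_subset_Rats by (auto simp: mem_mixed_int_iff)
  \<comment> \<open>Variable 0 is the objective value; variable \<open>1 + i\<close> is the \<open>i\<close>-th coordinate of a second-level point.\<close>
  define E where "E = (\<lambda>f :: nat \<Rightarrow> real. f 0 = (\<Sum>j<n. real_of_rat (d $ j) * f (1 + j))
    \<and> (\<forall>i<n. 0 \<le> f (1 + i)) \<and> (\<forall>i<r. f (1 + i) = y $ i)
    \<and> (\<forall>i<m. real_of_rat (b $ i) - s i \<le> (\<Sum>j<n. real_of_rat (G $$ (i, j)) * f (1 + j))))"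
  have "rat_system (1 + n) E"
    unfolding E_def
    by (intro rat_intros rat_affine_const s y_rat Rats_of_rat Rats_0 finite_lessThan)
      (use r in auto)
  then have sys: "rat_system 1 (\<lambda>f. \<exists>g. E (\<lambda>i. if i < 1 then f i else g i))"
    by (rule rat_system_ex)
  let ?v = "\<Sum>j<n. real_of_rat (d $ j) * y $ j"
  have "(\<lambda>_. ?v) (0::nat) \<in> \<rat>"
  proof (rule rat_system_min_rational[OF sys])
    have "E (\<lambda>i. if i < 1 then ?v else y $ (i - 1))"
      using yl unfolding E_def level by simp
    then show "\<exists>g. E (\<lambda>i. if i < 1 then ?v else g i)" by (rule exI[of _ "\<lambda>i. y $ (i - 1)"])
  next
    fix f :: "nat \<Rightarrow> real" assume "\<exists>g. E (\<lambda>i. if i < 1 then f i else g i)"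
    then obtain g where g: "E (\<lambda>i. if i < 1 then f i else g i)" by blast
    let ?y = "vec n (\<lambda>j. g (1 + j))"
    have "?y \<in> level_set n A G b x" using g unfolding E_def level by simp
    moreover have "?y \<in> mixed_int r n"
      using g ym r unfolding E_def mem_mixed_int_iff by simp
    ultimately have "?v \<le> (\<Sum>j<n. real_of_rat (d $ j) * ?y $ j)" using y unfolding react by blast
    also have "\<dots> = f 0" using g unfolding E_def by simp
    finally show "?v \<le> f 0" .
  qed
  then show ?thesis .
qed

text \<open>
  The points of the bilevel feasible region with prescribed integer-constrained coordinates share
  their linking variables, hence their second-level feasible set and its optimal value. If there is
  such a point at all, its second-level part \<open>y0\<close> attains this value, and membership in the reaction set
  becomes the linear inequality \<open>d\<^sup>2y \<le> d\<^sup>2y0\<close>.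
\<close>

lemma rational_polyhedron_bilevel_fibre:
  fixes \<gamma> :: "nat \<Rightarrow> int"
  assumes r: "r1 \<le> n1" "r2 \<le> n2"
    and A1: "A1 \<in> carrier_mat m1 n1" "G1 \<in> carrier_mat m1 n2" "b1 \<in> carrier_vec m1"
    and A2: "A2 \<in> carrier_mat m2 n1" "G2 \<in> carrier_mat m2 n2" "b2 \<in> carrier_vec m2"
    and d2: "d2 \<in> carrier_vec n2"
    and linking: "linking A2 \<subseteq> {..<r1}"
  shows "rational_polyhedron (n1 + n2)
    {z \<in> bilevel_feasible r1 n1 r2 n2 A1 G1 b1 A2 G2 b2 d2.
      \<forall>i \<in> {..<r1} \<union> {n1..<n1 + r2}. z $ i = of_int (\<gamma> i)}" (is "rational_polyhedron _ ?F")
proof (cases "?F = {}")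
  case True
  then show ?thesis by (simp only: rational_polyhedron_empty)
next
  case False
  have split: "(\<forall>i \<in> {..<r1} \<union> {n1..<n1 + r2}. (x @\<^sub>v y) $ i = of_int (\<gamma> i)) \<longleftrightarrow>
      (\<forall>i<r1. x $ i = of_int (\<gamma> i)) \<and> (\<forall>i<r2. y $ i = of_int (\<gamma> (n1 + i)))"
    if xy: "x \<in> carrier_vec n1" "y \<in> carrier_vec n2" for x y :: "real vec"
  proof -
    have "(\<forall>i \<in> {n1..<n1 + r2}. (x @\<^sub>v y) $ i = of_int (\<gamma> i)) \<longleftrightarrow>
        (\<forall>i<r2. (x @\<^sub>v y) $ (n1 + i) = of_int (\<gamma> (n1 + i)))"
      by (auto simp: nat_le_iff_add)
    with xy r show ?thesis by (auto simp: ball_Un)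
  qed
  from False obtain z0 where "z0 \<in> ?F" by blast
  then obtain x0 y0 where "x0 \<in> carrier_vec n1" "y0 \<in> carrier_vec n2" "x0 @\<^sub>v y0 \<in> ?F"
    unfolding bilevel_feasible_def mixed_int_def by blast
  then have x0: "x0 \<in> carrier_vec n1" "\<And>i. i < r1 \<Longrightarrow> x0 $ i = of_int (\<gamma> i)"
    and y0: "y0 \<in> rational_reaction r2 n2 A2 G2 b2 d2 x0"
    using split by (auto simp: append_mem_bilevel_feasible_iff)
  let ?v = "\<lambda>y. \<Sum>j<n2. real_of_rat (d2 $ j) * y $ j"
  note level1 = mem_level_set_iff[OF A1]
  note level2 = mem_level_set_iff[OF A2]
  note react = mem_rational_reaction_iff[OF d2]
  have same_level: "level_set n2 A2 G2 b2 x = level_set n2 A2 G2 b2 x0"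
    if x: "x \<in> carrier_vec n1" "\<And>i. i < r1 \<Longrightarrow> x $ i = of_int (\<gamma> i)" for x
  proof -
    have "(\<Sum>j<n1. real_of_rat (A2 $$ (i, j)) * x $ j)
        = (\<Sum>j<n1. real_of_rat (A2 $$ (i, j)) * x0 $ j)" if "i < m2" for i
      using x(2) x0(2) that by (simp add: linking_sum_eq[OF A2(1) linking r(1)])
    then show ?thesis using level2[OF x(1)] level2[OF x0(1)] by auto
  qed
  have v0: "?v y0 \<in> \<rat>"
  proof (rule optimal_value_rational[OF A2 d2 x0(1) r(2) _ y0])
    fix i assume "i < m2"
    then show "(\<Sum>j<n1. real_of_rat (A2 $$ (i, j)) * x0 $ j) \<in> \<rat>"
      using x0(2) by (auto simp: linking_sum_eq[OF A2(1) linking r(1)] intro!: Rats_sum)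
  qed
  define E where "E = (\<lambda>f :: nat \<Rightarrow> real. (\<forall>i<n1. 0 \<le> f i) \<and> (\<forall>i<n2. 0 \<le> f (n1 + i))
    \<and> (\<forall>i \<in> {..<r1} \<union> {n1..<n1 + r2}. f i = of_int (\<gamma> i))
    \<and> (\<forall>i<m1. real_of_rat (b1 $ i) - (\<Sum>j<n1. real_of_rat (A1 $$ (i, j)) * f j)
      \<le> (\<Sum>j<n2. real_of_rat (G1 $$ (i, j)) * f (n1 + j)))
    \<and> (\<forall>i<m2. real_of_rat (b2 $ i) - (\<Sum>j<n1. real_of_rat (A2 $$ (i, j)) * f j)
      \<le> (\<Sum>j<n2. real_of_rat (G2 $$ (i, j)) * f (n1 + j)))
    \<and> (\<Sum>j<n2. real_of_rat (d2 $ j) * f (n1 + j)) \<le> ?v y0)"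
  have "rat_system (n1 + n2) E"
    unfolding E_def
    by (intro rat_intros rat_affine_const v0 Rats_of_rat Rats_of_int Rats_0 finite_lessThan)
      (use r in auto)
  then have "rational_polyhedron (n1 + n2) {z \<in> carrier_vec (n1 + n2). E (($) z)}"
    by (rule rational_polyhedron_solutions)
  also have "{z \<in> carrier_vec (n1 + n2). E (($) z)} = ?F"
  proof -
    have F_carrier: "z \<in> carrier_vec (n1 + n2)" if "z \<in> ?F" for z
      using that unfolding bilevel_feasible_def mixed_int_def by auto
    have E_iff: "E (($) (x @\<^sub>v y)) \<longleftrightarrow> x @\<^sub>v y \<in> ?F"
      if xy: "x \<in> carrier_vec n1" "y \<in> carrier_vec n2" for x y
    proof -
      have E: "E (($) (x @\<^sub>v y)) \<longleftrightarrow> (\<forall>i<n1. 0 \<le> x $ i)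
        \<and> (\<forall>i<r1. x $ i = of_int (\<gamma> i)) \<and> (\<forall>i<r2. y $ i = of_int (\<gamma> (n1 + i)))
        \<and> y \<in> level_set n2 A1 G1 b1 x \<and> y \<in> level_set n2 A2 G2 b2 x \<and> ?v y \<le> ?v y0"
        unfolding E_def level1[OF xy(1)] level2[OF xy(1)] split[OF xy] using xy by auto
      have F: "x @\<^sub>v y \<in> ?F \<longleftrightarrow> x \<in> mixed_int r1 n1 \<and> y \<in> mixed_int r2 n2
        \<and> y \<in> level_set n2 A1 G1 b1 x \<and> y \<in> rational_reaction r2 n2 A2 G2 b2 d2 x
        \<and> (\<forall>i<r1. x $ i = of_int (\<gamma> i)) \<and> (\<forall>i<r2. y $ i = of_int (\<gamma> (n1 + i)))"
        using append_mem_bilevel_feasible_iff[OF xy(1)] split[OF xy] by auto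
      show ?thesis
      proof
        assume e: "E (($) (x @\<^sub>v y))"
        then have "x \<in> mixed_int r1 n1" "y \<in> mixed_int r2 n2"
          using xy unfolding E level1[OF xy(1)] mem_mixed_int_iff by auto
        moreover have "y \<in> rational_reaction r2 n2 A2 G2 b2 d2 x"
          using e y0 \<open>y \<in> mixed_int r2 n2\<close> same_level[OF xy(1)] unfolding E react
          by (auto intro: order_trans)
        ultimately show "x @\<^sub>v y \<in> ?F" using e unfolding E F by blast
      next
        assume f: "x @\<^sub>v y \<in> ?F"
        then have "?v y \<le> ?v y0"
          using y0 same_level[OF xy(1)] unfolding F react by auto
        with f show "E (($) (x @\<^sub>v y))"
          unfolding E F react mem_mixed_int_iff by auto
      qed
    qed
    have "E (($) z) \<longleftrightarrow> z \<in> ?F" if "z \<in> carrier_vec (n1 + n2)" for z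
      using E_iff[OF vec_first_carrier vec_last_carrier, of z z]
      unfolding vec_first_last_append[OF that] .
    with F_carrier show ?thesis by blast
  qed
  finally show ?thesis .
qed

theorem theorem1:
  fixes n1 n2 r1 r2 m1 m2 :: nat
    and A1 G1 A2 G2 :: "rat mat" and b1 b2 d2 :: "rat vec"
  assumes "r1 \<le> n1" and "r2 \<le> n2"
    and "A1 \<in> carrier_mat m1 n1" and "G1 \<in> carrier_mat m1 n2" and "b1 \<in> carrier_vec m1"
    and "A2 \<in> carrier_mat m2 n1" and "G2 \<in> carrier_mat m2 n2" and "b2 \<in> carrier_vec m2"
    and "d2 \<in> carrier_vec n2"
    and "bounded_vec (lp_relaxation n1 n2 A1 G1 b1 A2 G2 b2)"
    and "linking A2 \<subseteq> {..<r1}"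
  shows "rational_polyhedron (n1 + n2) (conv (bilevel_feasible r1 n1 r2 n2 A1 G1 b1 A2 G2 b2 d2))"
proof -
  let ?F = "bilevel_feasible r1 n1 r2 n2 A1 G1 b1 A2 G2 b2 d2"
  let ?J = "{..<r1} \<union> {n1..<n1 + r2}"
  let ?fibre = "\<lambda>\<gamma> :: nat \<Rightarrow> int. {z \<in> ?F. \<forall>i\<in>?J. z $ i = of_int (\<gamma> i)}"
  have "lp_relaxation n1 n2 A1 G1 b1 A2 G2 b2 \<subseteq> carrier_vec (n1 + n2)"
    unfolding lp_relaxation_def level_set_def by auto
  with \<open>bounded_vec _\<close> have "coord_bounded (n1 + n2) (lp_relaxation n1 n2 A1 G1 b1 A2 G2 b2)"
    by (rule coord_bounded_if_bounded_vec)
  then obtain B where B: "\<And>z i. z \<in> ?F \<Longrightarrow> i < n1 + n2 \<Longrightarrow> \<bar>z $ i\<bar> \<le> B"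
    using bilevel_feasible_subset_lp_relaxation unfolding coord_bounded_def by blast
  let ?\<Gamma> = "PiE ?J (\<lambda>_. {- \<lceil>B\<rceil>..\<lceil>B\<rceil>})"
  have union: "(\<Union>\<gamma>\<in>?\<Gamma>. ?fibre \<gamma>) = ?F"
  proof
    show "?F \<subseteq> (\<Union>\<gamma>\<in>?\<Gamma>. ?fibre \<gamma>)"
    proof
      fix z assume z: "z \<in> ?F"
      then obtain x y where xy: "z = x @\<^sub>v y" "x \<in> mixed_int r1 n1" "y \<in> mixed_int r2 n2"
        unfolding bilevel_feasible_def by blast
      have int: "z $ i \<in> \<int>" if "i \<in> ?J" for i
        using that xy assms(1,2) by (auto simp: mem_mixed_int_iff)
      define \<gamma> where "\<gamma> = restrict (\<lambda>i. \<lfloor>z $ i\<rfloor>) ?J"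
      have \<gamma>: "z $ i = of_int (\<gamma> i)" if "i \<in> ?J" for i
        using int[OF that] that by (auto simp: \<gamma>_def elim: Ints_cases)
      have "\<gamma> i \<in> {- \<lceil>B\<rceil>..\<lceil>B\<rceil>}" if "i \<in> ?J" for i
      proof -
        have "\<bar>of_int (\<gamma> i)\<bar> \<le> B" using B[OF z, of i] \<gamma>[OF that] that assms(1,2) by auto
        then show ?thesis by (simp add: abs_le_iff) linarith
      qed
      then have "\<gamma> \<in> ?\<Gamma>" by (auto simp: \<gamma>_def)
      with z \<gamma> show "z \<in> (\<Union>\<gamma>\<in>?\<Gamma>. ?fibre \<gamma>)" by blast
    qed
  qed auto
  have "rational_polyhedron (n1 + n2) (conv (\<Union>\<gamma>\<in>?\<Gamma>. ?fibre \<gamma>))"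
  proof (rule rational_polyhedron_conv_UN)
    show "finite ?\<Gamma>" by (intro finite_PiE) auto
    show "rational_polyhedron (n1 + n2) (?fibre \<gamma>)" for \<gamma>
      using assms by (intro rational_polyhedron_bilevel_fibre)
    show "coord_bounded (n1 + n2) (\<Union>\<gamma>\<in>?\<Gamma>. ?fibre \<gamma>)"
      unfolding union coord_bounded_def using B by blast
  qed
  then show ?thesis unfolding union .
qed

end
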